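(* Let $G$ be a finite simple undirected graph that is $\{P_3\cup P_2,\ \mathrm{gem}\}$-free. Then $\chi(G)\le 2\,\omega(G)$.
   Context: All graphs are finite, simple and undirected. $\chi(G)$ is the chromatic number and $\omega(G)$ the clique number of $G$. $P_n$ denotes the path on $n$ vertices and $K_n$ the complete graph on $n$ vertices. $P_3\cup P_2$ is the disjoint union of a path on 3 vertices and a path on 2 vertices. The gem is the graph $K_1+P_4$ (the join of a single vertex with a path on 4 vertices, i.e. a $P_4$ together with one extra vertex adjacent to all four vertices of the path). For a family $\mathcal{F}$ of graphs, $G$ is $\mathcal{F}$-free if no induced subgraph of $G$ is isomorphic to a member of $\mathcal{F}$. *)

theory Defs
  imports "Graph_Theory.Graph_Theory"
begin

text \<open>
  A finite simple undirected graph is a term satisfying the locale predicate \<^locale>\<open>graph\<close>,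
  i.e. a finite, loop-free symmetric digraph without parallel arcs; an undirected edge is
  represented by the two opposite arcs. The null graph is allowed.
\<close>

definition path_graph :: "nat \<Rightarrow> nat pair_pre_digraph" where
  "path_graph n = \<lparr> pverts = {..<n},
     parcs = {(i, j). i < n \<and> j < n \<and> (j = Suc i \<or> i = Suc j)} \<rparr>"

definition complete_graph :: "nat \<Rightarrow> nat pair_pre_digraph" where
  "complete_graph n = \<lparr> pverts = {..<n}, parcs = {(i, j). i < n \<and> j < n \<and> i \<noteq> j} \<rparr>"

definition disjoint_union ::
    "'a pair_pre_digraph \<Rightarrow> 'b pair_pre_digraph \<Rightarrow> ('a + 'b) pair_pre_digraph" where
  "disjoint_union G H = \<lparr> pverts = pverts G <+> pverts H,
     parcs = map_prod Inl Inl ` parcs G \<union> map_prod Inr Inr ` parcs H \<rparr>"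

definition graph_join ::
    "'a pair_pre_digraph \<Rightarrow> 'b pair_pre_digraph \<Rightarrow> ('a + 'b) pair_pre_digraph" where
  "graph_join G H = \<lparr> pverts = pverts G <+> pverts H,
     parcs = map_prod Inl Inl ` parcs G \<union> map_prod Inr Inr ` parcs H
       \<union> (Inl ` pverts G) \<times> (Inr ` pverts H) \<union> (Inr ` pverts H) \<times> (Inl ` pverts G) \<rparr>"

definition P3_union_P2 :: "(nat + nat) pair_pre_digraph" where
  "P3_union_P2 = disjoint_union (path_graph 3) (path_graph 2)"

definition gem :: "(nat + nat) pair_pre_digraph" where
  "gem = graph_join (complete_graph 1) (path_graph 4)"

definition free_of :: "('c, 'd) pre_digraph set \<Rightarrow> ('a, 'b) pre_digraph \<Rightarrow> bool" where
  "free_of \<F> G \<longleftrightarrow> \<not> (\<exists>H. induced_subgraph H G \<and> (\<exists>F \<in> \<F>. digraph_iso H F))"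

definition proper_coloring :: "('a, 'b) pre_digraph \<Rightarrow> nat \<Rightarrow> ('a \<Rightarrow> nat) \<Rightarrow> bool" where
  "proper_coloring G k c \<longleftrightarrow>
     (\<forall>v \<in> verts G. c v < k) \<and> (\<forall>u v. u \<rightarrow>\<^bsub>G\<^esub> v \<longrightarrow> c u \<noteq> c v)"

definition chromatic_number :: "('a, 'b) pre_digraph \<Rightarrow> nat" (\<open>\<chi>\<close>) where
  "\<chi> G = (LEAST k. \<exists>c. proper_coloring G k c)"

definition clique :: "('a, 'b) pre_digraph \<Rightarrow> 'a set \<Rightarrow> bool" where
  "clique G S \<longleftrightarrow> S \<subseteq> verts G \<and> pairwise (\<lambda>u v. u \<rightarrow>\<^bsub>G\<^esub> v) S"

definition clique_number :: "('a, 'b) pre_digraph \<Rightarrow> nat" (\<open>\<omega>\<close>) where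
  "\<omega> G = Max {card S | S. clique G S}"

lemma pair_graph_path_graph: "pair_graph (path_graph n)"
proof -
  have "finite (parcs (path_graph n))"
    by (rule finite_subset[of _ "{..<n} \<times> {..<n}"]) (auto simp: path_graph_def)
  then show ?thesis
    by unfold_locales (auto simp: path_graph_def symmetric_def intro!: symI)
qed

lemma pair_graph_complete_graph: "pair_graph (complete_graph n)"
proof -
  have "finite (parcs (complete_graph n))"
    by (rule finite_subset[of _ "{..<n} \<times> {..<n}"]) (auto simp: complete_graph_def)
  then show ?thesis
    by unfold_locales (auto simp: complete_graph_def symmetric_def intro!: symI)
qed

lemma complete_digraph_complete_graph: "K\<^bsub>n\<^esub> (with_proj (complete_graph n))"
  by (auto simp: complete_digraph_pair_def complete_graph_def)

lemma pair_graph_disjoint_union: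
  assumes "pair_graph G" "pair_graph H"
  shows "pair_graph (disjoint_union G H)"
proof -
  interpret G: pair_graph G by fact
  interpret H: pair_graph H by fact
  show ?thesis
    using G.pair_sym_arcs H.pair_sym_arcs
    by unfold_locales
      (auto simp: disjoint_union_def symmetric_def sym_def
        dest: G.arc_fst_in_verts G.arc_snd_in_verts H.arc_fst_in_verts H.arc_snd_in_verts
          G.pair_no_loops H.pair_no_loops)
qed

lemma pair_graph_graph_join:
  assumes "pair_graph G" "pair_graph H"
  shows "pair_graph (graph_join G H)"
proof -
  interpret G: pair_graph G by fact
  interpret H: pair_graph H by fact
  show ?thesis
    using G.pair_sym_arcs H.pair_sym_arcs
    by unfold_locales
      (auto simp: graph_join_def symmetric_def sym_def
        dest: G.arc_fst_in_verts G.arc_snd_in_verts H.arc_fst_in_verts H.arc_snd_in_verts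
          G.pair_no_loops H.pair_no_loops)
qed

lemma (in graph) chromatic_number_coloring: "\<exists>c. proper_coloring G (\<chi> G) c"
proof -
  obtain f where f: "bij_betw f (verts G) {0..<card (verts G)}"
    using ex_bij_betw_finite_nat[OF finite_verts] by blast
  have "proper_coloring G (card (verts G)) f"
    unfolding proper_coloring_def
    using bij_betwE[OF f] bij_betw_imp_inj_on[OF f]
    by (auto dest: inj_onD adj_in_verts adj_not_same)
  then show ?thesis
    unfolding chromatic_number_def by (intro LeastI) blast
qed

lemma (in graph) clique_number_clique: "\<exists>S. clique G S \<and> card S = \<omega> G"
  and clique_number_upper: "clique G S \<Longrightarrow> card S \<le> \<omega> G"
proof -
  have fin: "finite {card S | S. clique G S}"
    by (rule finite_subset[of _ "card ` Pow (verts G)"]) (auto simp: clique_def)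
  moreover have "clique G {}"
    by (simp add: clique_def)
  ultimately have "\<omega> G \<in> {card S | S. clique G S}"
    unfolding clique_number_def by (intro Max_in) auto
  then show "\<exists>S. clique G S \<and> card S = \<omega> G" by auto
  show "card S \<le> \<omega> G" if "clique G S"
    unfolding clique_number_def using fin that by (intro Max_ge) auto
qed

end

theory Submission
  imports Defs
begin

text \<open>
  Fix a maximum clique \<open>A\<close> and attach to every vertex \<open>x\<close> the set \<open>missed x\<close> of the members of \<open>A\<close>
  that are not adjacent to \<open>x\<close>; a member of \<open>A\<close> misses exactly itself, and by maximality no missed
  set is empty. These sets control the graph. If \<open>missed x \<union> missed y \<noteq> A\<close>, then \<open>x\<close> and \<open>y\<close> have a
  common neighbour in \<open>A\<close>, and a gem centred there is avoided only if adjacent \<open>x\<close> and \<open>y\<close> have equal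
  or disjoint missed sets (\<open>missed_adjacent\<close>) and nonadjacent ones comparable missed sets
  (\<open>missed_nonadjacent\<close>). If three vertices miss two common members of \<open>A\<close>, they do not induce a path,
  because these two members would complete it to \<open>P\<^sub>3 \<union> P\<^sub>2\<close> (\<open>no_P3_missing_edge\<close>). So the vertices
  that miss exactly \<open>S\<close> form disjoint cliques of size at most \<open>card S\<close> and can be coloured with the
  elements of \<open>S\<close>.

  Two kinds of vertex sets can be coloured with only \<open>\<omega>\<close> colours. In the first, adjacent vertices have
  equal or disjoint missed sets: every vertex gets a colour from its own missed set
  (\<open>laminar_colorable\<close>). In the second, any two missed sets share at least two elements: a vertex that
  misses all of \<open>A\<close>, or is adjacent to a vertex with the same missed set, has a closed neighbourhood
  that is a union of components; a neighbourhood contains no \<open>P\<^sub>4\<close>, hence is perfect, and can be split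
  off. Every remaining vertex takes one of its neighbours in \<open>A\<close> as its colour
  (\<open>intersecting_colorable\<close>).

  Vertices that miss at most half of \<open>A\<close> form a set of the first kind. For \<open>\<omega> \<ge> 2\<close> the vertices that
  miss more form a set of the second kind, with one exception: two different missed sets of size \<open>(\<omega> + 1) / 2\<close> may
  share just one element. Their complements in \<open>A\<close> are disjoint, so for \<open>\<omega> \<noteq> 3\<close> there are at most
  two such sets, and moving one of the two classes to the first part leaves two sets of \<open>\<omega>\<close> colours
  each (\<open>colorable_if_card_neq_3\<close>).

  For \<open>\<omega> = 3\<close> all three sets of size two may occur. Here the vertices that miss one member of \<open>A\<close> are
  \<open>3\<close>-colourable, each class of vertices attached to a single member of \<open>A\<close> is \<open>2\<close>-colourable, and the
  work lies in fitting the vertices remote from \<open>A\<close> into six colours (\<open>six_colorable\<close>).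
\<close>

section \<open>Induced copies of a graph\<close>

context graph
begin

abbreviation adjacent :: "'a \<Rightarrow> 'a \<Rightarrow> bool" (infix \<open>\<sim>\<close> 50) where
  "u \<sim> v \<equiv> u \<rightarrow>\<^bsub>G\<^esub> v"

lemma adj_sym: "u \<sim> v \<Longrightarrow> v \<sim> u"
  using sym_arcs by (rule arcs_ends_symmetric)

lemma not_adj_sym: "\<not> u \<sim> v \<Longrightarrow> \<not> v \<sim> u"
  using adj_sym by blast

lemma adj_irrefl: "\<not> v \<sim> v"
  using adj_not_same by blast

text \<open>
  The inverse of \<open>f\<close> is an isomorphism from the subgraph induced on the image. It determines the map
  on arcs because \<open>G\<close> has no parallel arcs.
\<close>

lemma induced_copyI:
  assumes F: "pair_graph F"
    and inj: "inj_on f (pverts F)" and sub: "f ` pverts F \<subseteq> verts G"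
    and adj: "\<And>i j. i \<in> pverts F \<Longrightarrow> j \<in> pverts F \<Longrightarrow> (i, j) \<in> parcs F \<longleftrightarrow> f i \<sim> f j"
  shows "\<exists>H. induced_subgraph H G \<and> digraph_iso H (with_proj F)"
proof (intro exI conjI)
  let ?X = "f ` pverts F"
  let ?g = "the_inv_into (pverts F) f"
  let ?h = "\<lparr> iso_verts = ?g, iso_arcs = (\<lambda>a. (?g (tail G a), ?g (head G a))),
               iso_head = snd, iso_tail = fst \<rparr>"
  interpret F: pair_graph F by fact
  have gf: "?g (f i) = i" if "i \<in> pverts F" for i
    using inj that by (rule the_inv_into_f_f)
  show "induced_subgraph (G \<restriction> ?X) G"
    using sub by (rule induced_induce)
  have ginj: "inj_on ?g ?X"
    using inj by (rule inj_on_the_inv_into)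
  have arc_inj: "inj_on (\<lambda>a. (?g (tail G a), ?g (head G a))) (arcs (G \<restriction> ?X))"
  proof (rule inj_onI)
    fix a b
    assume a: "a \<in> arcs (G \<restriction> ?X)" and b: "b \<in> arcs (G \<restriction> ?X)"
      and "(?g (tail G a), ?g (head G a)) = (?g (tail G b), ?g (head G b))"
    then have "tail G a = tail G b" "head G a = head G b"
      using ginj by (auto dest: inj_onD)
    then show "a = b"
      using a b no_multi_arcs[of a b] by (auto simp: arc_to_ends_def)
  qed
  have "pre_digraph.digraph_isomorphism (G \<restriction> ?X) ?h"
    unfolding pre_digraph.digraph_isomorphism_def
    using wellformed_induce_subgraph ginj arc_inj by auto
  moreover have "with_proj F = app_iso ?h (G \<restriction> ?X)"
  proof (intro pre_digraph.equality)
    show "verts (with_proj F) = verts (app_iso ?h (G \<restriction> ?X))"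
      by (force simp: gf image_iff)
    show "arcs (with_proj F) = arcs (app_iso ?h (G \<restriction> ?X))"
    proof (intro equalityI subsetI)
      fix e
      assume e: "e \<in> arcs (with_proj F)"
      obtain i j where ij: "e = (i, j)" by (cases e)
      with e have v: "i \<in> pverts F" "j \<in> pverts F"
        using F.in_arcsD1 F.in_arcsD2 by auto
      then have "f i \<sim> f j"
        using adj e ij by auto
      then obtain a where "a \<in> arcs G" "tail G a = f i" "head G a = f j"
        by (rule reachableE)
      then show "e \<in> arcs (app_iso ?h (G \<restriction> ?X))"
        using v gf ij by (force simp: image_iff)
    next
      fix e
      assume "e \<in> arcs (app_iso ?h (G \<restriction> ?X))"
      then obtain a i j where a: "a \<in> arcs G" "tail G a = f i" "head G a = f j"
        and v: "i \<in> pverts F" "j \<in> pverts F" and e: "e = (?g (f i), ?g (f j))"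
        by auto
      have "f i \<sim> f j"
        using a by (intro dominatesI[of a]) (auto simp: arc_to_ends_def)
      then show "e \<in> arcs (with_proj F)"
        using adj[OF v] e v by (simp add: gf)
    qed
  qed auto
  ultimately show "digraph_iso (G \<restriction> ?X) (with_proj F)"
    unfolding digraph_iso_def by blast
qed

end

section \<open>Colouring sets of vertices\<close>

context graph
begin

text \<open>
  The colouring is required to be proper only inside \<open>X\<close>, so that colourings of the parts of a
  partition of the vertices can be put together.
\<close>

definition colorable :: "'a set \<Rightarrow> nat \<Rightarrow> bool" where
  "colorable X k \<longleftrightarrow>
     (\<exists>c. (\<forall>x\<in>X. c x < k) \<and> (\<forall>x\<in>X. \<forall>y\<in>X. x \<sim> y \<longrightarrow> c x \<noteq> (c y :: nat)))"

lemma colorableI: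
  fixes c :: "'a \<Rightarrow> 'c"
  assumes "finite C" "card C \<le> k" "c ` X \<subseteq> C"
    and "\<And>x y. x \<in> X \<Longrightarrow> y \<in> X \<Longrightarrow> x \<sim> y \<Longrightarrow> c x \<noteq> c y"
  shows "colorable X k"
proof -
  obtain h :: "'c \<Rightarrow> nat" where h: "bij_betw h C {0..<card C}"
    using ex_bij_betw_finite_nat[OF assms(1)] by blast
  show ?thesis
    unfolding colorable_def
  proof (intro exI[of _ "h \<circ> c"] conjI ballI impI)
    fix x assume "x \<in> X"
    then show "(h \<circ> c) x < k"
      using assms(2) bij_betwE[OF h] subsetD[OF assms(3), of "c x"] by (auto intro: less_le_trans)
  next
    fix x y assume "x \<in> X" "y \<in> X" "x \<sim> y"
    then show "(h \<circ> c) x \<noteq> (h \<circ> c) y"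
      using assms(3,4) inj_onD[OF bij_betw_imp_inj_on[OF h], of "c x" "c y"] by auto
  qed
qed

lemma colorableE:
  assumes "colorable X k" "finite C" "card C = k"
  obtains c where "c ` X \<subseteq> C" "\<And>x y. x \<in> X \<Longrightarrow> y \<in> X \<Longrightarrow> x \<sim> y \<Longrightarrow> c x \<noteq> c y"
proof -
  obtain c where c: "\<forall>x\<in>X. c x < k" "\<forall>x\<in>X. \<forall>y\<in>X. x \<sim> y \<longrightarrow> c x \<noteq> (c y :: nat)"
    using assms(1) by (auto simp: colorable_def)
  obtain h where h: "bij_betw h {0..<k} C"
    using ex_bij_betw_nat_finite[OF assms(2)] assms(3) by blast
  show ?thesis
  proof
    show "(h \<circ> c) ` X \<subseteq> C"
      using c(1) bij_betwE[OF h] by auto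
    show "(h \<circ> c) x \<noteq> (h \<circ> c) y" if "x \<in> X" "y \<in> X" "x \<sim> y" for x y
      using c that inj_onD[OF bij_betw_imp_inj_on[OF h], of "c x" "c y"] by auto
  qed
qed

lemma colorable_mono:
  "colorable Y l \<Longrightarrow> X \<subseteq> Y \<Longrightarrow> l \<le> k \<Longrightarrow> colorable X k"
  unfolding colorable_def by (elim exE, rule exI) (auto intro: less_le_trans)

lemma colorable_Un:
  assumes "colorable X k" "colorable Y l"
  shows "colorable (X \<union> Y) (k + l)"
proof -
  obtain c d where c: "\<forall>x\<in>X. c x < k" "\<forall>x\<in>X. \<forall>y\<in>X. x \<sim> y \<longrightarrow> c x \<noteq> (c y :: nat)"
    and d: "\<forall>x\<in>Y. d x < l" "\<forall>x\<in>Y. \<forall>y\<in>Y. x \<sim> y \<longrightarrow> d x \<noteq> (d y :: nat)"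
    using assms by (auto simp: colorable_def)
  show ?thesis
    unfolding colorable_def
  proof (intro exI[of _ "\<lambda>x. if x \<in> X then c x else k + d x"] conjI ballI impI)
    fix x y assume "x \<in> X \<union> Y" "y \<in> X \<union> Y" "x \<sim> y"
    moreover from this have "c x < k" if "x \<in> X"
      using c(1) that by blast
    moreover have "c y < k" if "y \<in> X"
      using c(1) that by blast
    ultimately show "(if x \<in> X then c x else k + d x) \<noteq> (if y \<in> X then c y else k + d y)"
      using c(2) d(2) by auto
  next
    fix x assume "x \<in> X \<union> Y"
    then show "(if x \<in> X then c x else k + d x) < k + l"
      using c(1) d(1) by (auto intro: trans_less_add1)
  qed
qed

lemma colorable_Un_anticomplete:
  assumes "colorable X k" "colorable Y k" "\<And>x y. x \<in> X \<Longrightarrow> y \<in> Y \<Longrightarrow> \<not> x \<sim> y"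
  shows "colorable (X \<union> Y) k"
proof -
  obtain c d where c: "\<forall>x\<in>X. c x < k" "\<forall>x\<in>X. \<forall>y\<in>X. x \<sim> y \<longrightarrow> c x \<noteq> (c y :: nat)"
    and d: "\<forall>x\<in>Y. d x < k" "\<forall>x\<in>Y. \<forall>y\<in>Y. x \<sim> y \<longrightarrow> d x \<noteq> (d y :: nat)"
    using assms(1,2) by (auto simp: colorable_def)
  show ?thesis
    unfolding colorable_def
  proof (intro exI[of _ "\<lambda>x. if x \<in> X then c x else d x"] conjI ballI impI)
    fix x y assume xy: "x \<in> X \<union> Y" "y \<in> X \<union> Y" "x \<sim> y"
    then have "x \<in> X \<longleftrightarrow> y \<in> X"
      using assms(3)[of x y] assms(3)[of y x] adj_sym[of x y] by blast
    then show "(if x \<in> X then c x else d x) \<noteq> (if y \<in> X then c y else d y)"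
      using xy c(2) d(2) by auto
  qed (use c(1) d(1) in auto)
qed

lemma colorable_independent:
  assumes "\<And>x y. x \<in> X \<Longrightarrow> y \<in> X \<Longrightarrow> \<not> x \<sim> y"
  shows "colorable X 1"
  unfolding colorable_def using assms by (intro exI[of _ "\<lambda>_. 0"]) auto

lemma chromatic_number_le:
  assumes "colorable (verts G) k"
  shows "\<chi> G \<le> k"
proof -
  obtain c where "\<forall>x\<in>verts G. c x < k" "\<forall>x\<in>verts G. \<forall>y\<in>verts G. x \<sim> y \<longrightarrow> c x \<noteq> (c y :: nat)"
    using assms by (auto simp: colorable_def)
  then have "proper_coloring G k c"
    using adj_in_verts by (simp add: proper_coloring_def)
  then show ?thesis
    unfolding chromatic_number_def by (intro Least_le) blast
qed

lemma clique_insert: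
  assumes "clique G Q" "v \<in> verts G" "\<And>q. q \<in> Q \<Longrightarrow> v \<sim> q"
  shows "clique G (insert v Q)"
  using assms(1,2) assms(3) adj_sym[OF assms(3)] by (simp add: clique_def pairwise_insert)

lemma finite_clique: "clique G Q \<Longrightarrow> finite Q"
  unfolding clique_def using finite_verts finite_subset by blast

end

section \<open>Graphs without an induced path on four vertices\<close>

context graph
begin

text \<open>
  A walk \<open>p q r s\<close> that repeats a vertex satisfies one of the disjuncts, since \<open>p = r\<close> and \<open>q = s\<close> give
  \<open>p \<sim> s\<close>, and \<open>p = s\<close> gives \<open>p \<sim> r\<close>; so exactly the induced paths on four vertices are excluded.
\<close>

definition P4_free :: "'a set \<Rightarrow> bool" where
  "P4_free X \<longleftrightarrow> (\<forall>p\<in>X. \<forall>q\<in>X. \<forall>r\<in>X. \<forall>s\<in>X. p \<sim> q \<longrightarrow> q \<sim> r \<longrightarrow> r \<sim> s \<longrightarrow>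
     p \<sim> r \<or> q \<sim> s \<or> p \<sim> s)"

text \<open>
  A maximal independent set of a \<open>P\<^sub>4\<close>-free graph meets every maximal clique. To see this, take \<open>s \<in> S\<close>
  with the most neighbours in \<open>Q\<close>. If \<open>s\<close> misses \<open>v \<in> Q\<close>, then some \<open>t \<in> S\<close> is adjacent to \<open>v\<close>, and any
  \<open>u \<in> Q\<close> adjacent to \<open>s\<close> is adjacent to \<open>t\<close> as well, since otherwise \<open>s u v t\<close> is an induced path; thus \<open>t\<close>
  has more neighbours in \<open>Q\<close>.
\<close>

lemma P4_free_clique_extends:
  assumes "P4_free X" and "S \<subseteq> X" "\<And>s t. s \<in> S \<Longrightarrow> t \<in> S \<Longrightarrow> \<not> s \<sim> t"
    and max: "\<And>v. v \<in> X - S \<Longrightarrow> \<exists>s\<in>S. s \<sim> v"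
    and Q: "clique G Q" "Q \<subseteq> X - S" "Q \<noteq> {}"
  shows "\<exists>s\<in>S. \<forall>v\<in>Q. s \<sim> v"
proof -
  let ?n = "\<lambda>s. {v \<in> Q. s \<sim> v}"
  have fin: "finite Q"
    using Q(1) by (rule finite_clique)
  obtain s0 where "s0 \<in> S"
    using max Q by blast
  moreover have "card (?n t) < Suc (card Q)" for t
    using card_mono[of Q "?n t"] fin by simp
  ultimately obtain s where s: "s \<in> S" and s_max: "\<And>t. t \<in> S \<Longrightarrow> card (?n t) \<le> card (?n s)"
    using arg_max_nat_lemma[of "\<lambda>s. s \<in> S" s0 "\<lambda>s. card (?n s)" "Suc (card Q)"] by blast
  have "s \<sim> v" if v: "v \<in> Q" for v
  proof (rule ccontr)
    assume nv: "\<not> s \<sim> v"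
    obtain t where t: "t \<in> S" "t \<sim> v"
      using max v Q(2) by blast
    have "?n s \<subset> ?n t"
    proof (rule psubsetI)
      show "?n s \<subseteq> ?n t"
      proof (rule subsetI)
        fix u assume u: "u \<in> ?n s"
        have "u \<sim> v"
          using u v nv pairwiseD[of _ Q u v] Q(1) by (auto simp: clique_def)
        moreover have "s \<sim> u" "v \<sim> t" "\<not> s \<sim> t"
          using u t(1) s assms(3) adj_sym[OF t(2)] by auto
        moreover have "s \<in> X" "t \<in> X" "u \<in> X" "v \<in> X"
          using assms(2) s t u v Q(2) by auto
        ultimately have "u \<sim> t"
          using assms(1) nv by (auto simp: P4_free_def)
        then show "u \<in> ?n t"
          using u adj_sym[of u t] by auto
      qed
    qed (use v t nv in blast)
    then have "card (?n s) < card (?n t)"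
      using fin by (intro psubset_card_mono) auto
    then show False
      using s_max[OF t(1)] by simp
  qed
  then show ?thesis
    using s by blast
qed

lemma maximal_independent_set:
  assumes "X \<subseteq> verts G"
  obtains S where "S \<subseteq> X" "\<And>s t. s \<in> S \<Longrightarrow> t \<in> S \<Longrightarrow> \<not> s \<sim> t"
    and "\<And>v. v \<in> X - S \<Longrightarrow> \<exists>s\<in>S. s \<sim> v"
proof -
  let ?I = "{S. S \<subseteq> X \<and> (\<forall>s\<in>S. \<forall>t\<in>S. \<not> s \<sim> t)}"
  have "finite ?I"
    using finite_subset[OF assms finite_verts] by (intro finite_subset[of ?I "Pow X"]) auto
  moreover have "{} \<in> ?I"
    by simp
  ultimately have "\<exists>S\<in>?I. \<forall>T\<in>?I. S \<subseteq> T \<longrightarrow> S = T"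
    by (intro finite_has_maximal) auto
  then obtain S where S: "S \<in> ?I" and max: "\<And>T. T \<in> ?I \<Longrightarrow> S \<subseteq> T \<Longrightarrow> S = T"
    by meson
  have "\<exists>s\<in>S. s \<sim> v" if v: "v \<in> X - S" for v
  proof (rule ccontr)
    assume "\<not> (\<exists>s\<in>S. s \<sim> v)"
    then have "insert v S \<in> ?I"
      using v S adj_irrefl adj_sym[of v] by blast
    then show False
      using max[of "insert v S"] v by blast
  qed
  then show thesis
    using S by (intro that[of S]) auto
qed

text \<open>
  Removing a maximal independent set lowers the clique number and costs one colour. Thus
  \<open>P\<^sub>4\<close>-free graphs are perfect.
\<close>

lemma P4_free_colorable:
  assumes "X \<subseteq> verts G" "P4_free X" "\<And>Q. clique G Q \<Longrightarrow> Q \<subseteq> X \<Longrightarrow> card Q \<le> k"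
  shows "colorable X k"
  using assms
proof (induction k arbitrary: X)
  case 0
  have "X = {}"
  proof (rule ccontr)
    assume "X \<noteq> {}"
    then obtain x where "x \<in> X" by blast
    then have "clique G {x}"
      using 0 by (auto simp: clique_def)
    then show False
      using 0(3)[of "{x}"] \<open>x \<in> X\<close> by simp
  qed
  then show ?case
    by (simp add: colorable_def)
next
  case (Suc k)
  obtain S where S: "S \<subseteq> X" "\<And>s t. s \<in> S \<Longrightarrow> t \<in> S \<Longrightarrow> \<not> s \<sim> t"
    and max: "\<And>v. v \<in> X - S \<Longrightarrow> \<exists>s\<in>S. s \<sim> v"
    by (rule maximal_independent_set[OF Suc.prems(1)]) (rule that)
  have "colorable (X - S) k"
  proof (rule Suc.IH)
    show "P4_free (X - S)"
      using Suc.prems(2) by (auto simp: P4_free_def)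
    fix Q assume Q: "clique G Q" "Q \<subseteq> X - S"
    show "card Q \<le> k"
    proof (cases "Q = {}")
      case False
      have "\<exists>s\<in>S. \<forall>v\<in>Q. s \<sim> v"
        using Suc.prems(2) S max Q False by (rule P4_free_clique_extends)
      then obtain s where s: "s \<in> S" "\<forall>v\<in>Q. s \<sim> v"
        by blast
      then have "clique G (insert s Q)"
        using Q S Suc.prems(1) by (intro clique_insert) auto
      moreover have "insert s Q \<subseteq> X" "s \<notin> Q"
        using s S Q by auto
      ultimately show ?thesis
        using Suc.prems(3)[of "insert s Q"] finite_clique[OF Q(1)] by simp
    qed simp
  qed (use Suc.prems(1) in auto)
  moreover have "colorable S 1"
    using S(2) by (rule colorable_independent)
  ultimately have "colorable ((X - S) \<union> S) (k + 1)"
    by (rule colorable_Un)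
  then show ?case
    by (rule colorable_mono) auto
qed

end

section \<open>The two forbidden configurations\<close>

lemma path_graph_small:
  "pverts (path_graph 2) = {0, 1}" "parcs (path_graph 2) = {(0, 1), (1, 0)}"
  "pverts (path_graph 3) = {0, 1, 2}" "parcs (path_graph 3) = {(0, 1), (1, 0), (1, 2), (2, 1)}"
  "pverts (path_graph 4) = {0, 1, 2, 3}"
  "parcs (path_graph 4) = {(0, 1), (1, 0), (1, 2), (2, 1), (2, 3), (3, 2)}"
  by (auto simp: path_graph_def numeral_eq_Suc less_Suc_eq)

lemma complete_graph_1: "pverts (complete_graph (Suc 0)) = {0}" "parcs (complete_graph (Suc 0)) = {}"
  by (auto simp: complete_graph_def)

lemma P3_union_P2_explicit:
  "pverts P3_union_P2 = {Inl 0, Inl 1, Inl 2, Inr 0, Inr 1}"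
  "parcs P3_union_P2 = {(Inl 0, Inl 1), (Inl 1, Inl 0), (Inl 1, Inl 2), (Inl 2, Inl 1),
     (Inr 0, Inr 1), (Inr 1, Inr 0)}"
  by (auto simp: P3_union_P2_def disjoint_union_def path_graph_small Plus_def)

lemma gem_explicit:
  "pverts gem = {Inl 0, Inr 0, Inr 1, Inr 2, Inr 3}"
  "parcs gem = {(Inl 0, Inr 0), (Inl 0, Inr 1), (Inl 0, Inr 2), (Inl 0, Inr 3),
     (Inr 0, Inl 0), (Inr 1, Inl 0), (Inr 2, Inl 0), (Inr 3, Inl 0),
     (Inr 0, Inr 1), (Inr 1, Inr 0), (Inr 1, Inr 2), (Inr 2, Inr 1), (Inr 2, Inr 3), (Inr 3, Inr 2)}"
  by (auto simp: gem_def graph_join_def path_graph_small Plus_def complete_graph_1)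

section \<open>The trace of a vertex on a maximum clique\<close>

locale P3_union_P2_gem_free_graph = graph +
  assumes free: "free_of {with_proj P3_union_P2, with_proj gem} G"
begin

lemma no_P3_union_P2:
  assumes "a \<sim> b" "b \<sim> c" "a \<noteq> c" "\<not> a \<sim> c" "d \<sim> e"
    and "\<not> a \<sim> d" "\<not> b \<sim> d" "\<not> c \<sim> d" "\<not> a \<sim> e" "\<not> b \<sim> e" "\<not> c \<sim> e"
  shows False
proof -
  define f :: "nat + nat \<Rightarrow> 'a" where
    "f = case_sum (\<lambda>i. if i = 0 then a else if i = 1 then b else c) (\<lambda>i. if i = 0 then d else e)"
  note sym = assms(1,2,5)[THEN adj_sym] assms(4,6-11)[THEN not_adj_sym]
  have distinct: "distinct [a, b, c, d, e]"
    using assms sym adj_irrefl by auto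
  have in_V: "a \<in> verts G" "b \<in> verts G" "c \<in> verts G" "d \<in> verts G" "e \<in> verts G"
    using assms(1,2,5)[THEN adj_in_verts(1)] assms(1,2,5)[THEN adj_in_verts(2)] by auto
  have pg: "pair_graph P3_union_P2"
    unfolding P3_union_P2_def by (intro pair_graph_disjoint_union pair_graph_path_graph)
  have "\<exists>H. induced_subgraph H G \<and> digraph_iso H (with_proj P3_union_P2)"
  proof (rule induced_copyI[OF pg, of f])
    show "inj_on f (pverts P3_union_P2)"
      using distinct by (auto simp: P3_union_P2_explicit(1) inj_on_def f_def)
    show "f ` pverts P3_union_P2 \<subseteq> verts G"
      using in_V by (auto simp: P3_union_P2_explicit(1) f_def)
    have "\<forall>i\<in>pverts P3_union_P2. \<forall>j\<in>pverts P3_union_P2. (i, j) \<in> parcs P3_union_P2 \<longleftrightarrow> f i \<sim> f j"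
      using assms sym by (simp add: P3_union_P2_explicit f_def adj_irrefl)
    then show "(i, j) \<in> parcs P3_union_P2 \<longleftrightarrow> f i \<sim> f j"
      if "i \<in> pverts P3_union_P2" "j \<in> pverts P3_union_P2" for i j
      using that by blast
  qed
  then show False
    using free by (auto simp: free_of_def)
qed

lemma no_gem:
  assumes "g \<sim> p" "g \<sim> q" "g \<sim> r" "g \<sim> s" "p \<sim> q" "q \<sim> r" "r \<sim> s"
    and "\<not> p \<sim> r" "\<not> p \<sim> s" "\<not> q \<sim> s"
  shows False
proof -
  define f :: "nat + nat \<Rightarrow> 'a" where
    "f = case_sum (\<lambda>i. g) (\<lambda>i. if i = 0 then p else if i = 1 then q else if i = 2 then r else s)"
  note sym = assms(1-7)[THEN adj_sym] assms(8-10)[THEN not_adj_sym]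
  have distinct: "distinct [g, p, q, r, s]"
    using assms sym adj_irrefl by auto
  have in_V: "g \<in> verts G" "p \<in> verts G" "q \<in> verts G" "r \<in> verts G" "s \<in> verts G"
    using assms(1-4)[THEN adj_in_verts(1)] assms(1-4)[THEN adj_in_verts(2)] by auto
  have pg: "pair_graph gem"
    unfolding gem_def
    by (intro pair_graph_graph_join pair_graph_path_graph pair_graph_complete_graph)
  have "\<exists>H. induced_subgraph H G \<and> digraph_iso H (with_proj gem)"
  proof (rule induced_copyI[OF pg, of f])
    show "inj_on f (pverts gem)"
      using distinct by (auto simp: gem_explicit(1) inj_on_def f_def)
    show "f ` pverts gem \<subseteq> verts G"
      using in_V by (auto simp: gem_explicit(1) f_def)
    have "\<forall>i\<in>pverts gem. \<forall>j\<in>pverts gem. (i, j) \<in> parcs gem \<longleftrightarrow> f i \<sim> f j"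
      using assms sym by (simp add: gem_explicit f_def adj_irrefl)
    then show "(i, j) \<in> parcs gem \<longleftrightarrow> f i \<sim> f j"
      if "i \<in> pverts gem" "j \<in> pverts gem" for i j
      using that by blast
  qed
  then show False
    using free by (auto simp: free_of_def)
qed

end

section \<open>The trace of a vertex on a maximum clique\<close>

locale P3_union_P2_gem_free_max_clique = P3_union_P2_gem_free_graph +
  fixes A
  assumes clique_A: "clique G A" and card_A: "card A = \<omega> G"
begin

definition missed :: "'a \<Rightarrow> 'a set" where
  "missed x = {a \<in> A. \<not> a \<sim> x}"

lemma missed_subset: "missed x \<subseteq> A"
  by (auto simp: missed_def)

lemma not_missed: "a \<in> A \<Longrightarrow> a \<notin> missed x \<Longrightarrow> a \<sim> x"
  by (simp add: missed_def)

lemma missed_not_adj: "a \<in> missed x \<Longrightarrow> \<not> a \<sim> x" "a \<in> missed x \<Longrightarrow> a \<in> A"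
  by (simp_all add: missed_def)

lemma finite_A: "finite A"
  using clique_A by (rule finite_clique)

lemma A_verts: "A \<subseteq> verts G"
  using clique_A by (simp add: clique_def)

lemma finite_missed: "finite (missed x)"
  using finite_A missed_subset by (rule rev_finite_subset)

lemma clique_adj: "clique G Q \<Longrightarrow> x \<in> Q \<Longrightarrow> y \<in> Q \<Longrightarrow> x \<noteq> y \<Longrightarrow> x \<sim> y"
  by (simp add: clique_def pairwise_def)

lemma adj_A: "a \<in> A \<Longrightarrow> b \<in> A \<Longrightarrow> a \<noteq> b \<Longrightarrow> a \<sim> b"
  using clique_A by (rule clique_adj)

lemma card_clique_le: "clique G Q \<Longrightarrow> card Q \<le> card A"
  using clique_number_upper card_A by simp

lemma missed_member: "a \<in> A \<Longrightarrow> missed a = {a}"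
  using adj_A adj_irrefl by (auto simp: missed_def)

text \<open>
  Otherwise \<open>x\<close> would enlarge the maximum clique.
\<close>

lemma missed_nonempty:
  assumes "x \<in> verts G"
  shows "missed x \<noteq> {}"
proof
  assume "missed x = {}"
  then have x: "a \<sim> x" if "a \<in> A" for a
    using that by (simp add: missed_def)
  then have "clique G (insert x A)" "x \<notin> A"
    using clique_insert[OF clique_A assms] adj_sym adj_irrefl by blast+
  then show False
    using card_clique_le[of "insert x A"] finite_A by simp
qed

text \<open>
  If \<open>k\<close> is a common neighbour in \<open>A\<close>, \<open>j\<close> is missed by both and \<open>i\<close> only by \<open>v\<close>, then \<open>j i u v\<close> is an induced
  path in the neighbourhood of \<open>k\<close>.
\<close>

lemma missed_adjacent:
  assumes "x \<sim> y" "missed x \<union> missed y \<noteq> A"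
  shows "missed x = missed y \<or> missed x \<inter> missed y = {}"
proof -
  have *: "missed v \<subseteq> missed u"
    if uv: "u \<sim> v" and k: "k \<in> A" "k \<notin> missed u" "k \<notin> missed v"
      and j: "j \<in> missed u" "j \<in> missed v" for u v k j
  proof
    fix i assume i: "i \<in> missed v"
    show "i \<in> missed u"
    proof (rule ccontr)
      assume ni: "i \<notin> missed u"
      have A: "i \<in> A" "j \<in> A"
        using i j missed_not_adj by auto
      have ne: "k \<noteq> j" "k \<noteq> i" "j \<noteq> i"
        using i j k ni by auto
      show False
      proof (rule no_gem)
        show "k \<sim> j" "k \<sim> i" "j \<sim> i"
          using A k ne adj_A by auto
        show "k \<sim> u" "k \<sim> v" "i \<sim> u" "u \<sim> v"
          using A k ni uv not_missed by auto
        show "\<not> j \<sim> u" "\<not> j \<sim> v" "\<not> i \<sim> v"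
          using i j missed_not_adj by auto
      qed
    qed
  qed
  obtain k where k: "k \<in> A" "k \<notin> missed x" "k \<notin> missed y"
    using assms(2) missed_subset by blast
  show ?thesis
  proof (rule disjCI)
    assume "missed x \<inter> missed y \<noteq> {}"
    then obtain j where j: "j \<in> missed x" "j \<in> missed y"
      by blast
    show "missed x = missed y"
      using *[OF assms(1) k j] *[OF adj_sym[OF assms(1)] k(1,3,2) j(2,1)] by (rule equalityI[rotated])
  qed
qed

text \<open>
  If \<open>i\<close> is missed only by \<open>y\<close> and \<open>j\<close> only by \<open>x\<close>, then \<open>x i j y\<close> is an induced path, and it lies in
  the neighbourhood of a common neighbour of \<open>x\<close> and \<open>y\<close> in \<open>A\<close>.
\<close>

lemma missed_nonadjacent:
  assumes "\<not> x \<sim> y" "missed x \<union> missed y \<noteq> A"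
  shows "missed x \<subseteq> missed y \<or> missed y \<subseteq> missed x"
proof (rule ccontr)
  assume "\<not> ?thesis"
  then obtain i j where i: "i \<in> missed y" "i \<notin> missed x" and j: "j \<in> missed x" "j \<notin> missed y"
    by blast
  obtain k where k: "k \<in> A" "k \<notin> missed x" "k \<notin> missed y"
    using assms(2) missed_subset by blast
  have A: "i \<in> A" "j \<in> A" and ne: "i \<noteq> j" "k \<noteq> i" "k \<noteq> j"
    using i j k missed_not_adj by auto
  show False
  proof (rule no_gem)
    show "k \<sim> x" "k \<sim> i" "k \<sim> j" "k \<sim> y" "i \<sim> j"
      using A ne k adj_A not_missed by auto
    show "x \<sim> i" "j \<sim> y"
      using A i j not_missed adj_sym by auto
    show "\<not> x \<sim> j" "\<not> x \<sim> y" "\<not> i \<sim> y"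
      using i j assms(1) missed_not_adj not_adj_sym by auto
  qed
qed

lemma no_P3_missing_edge:
  assumes "2 \<le> card (missed x \<inter> missed y \<inter> missed z)" "x \<sim> y" "y \<sim> z" "x \<noteq> z"
  shows "x \<sim> z"
proof (rule ccontr)
  assume "\<not> x \<sim> z"
  obtain T where "T \<subseteq> missed x \<inter> missed y \<inter> missed z" "card T = 2"
    by (rule obtain_subset_with_card_n[OF assms(1)])
  then obtain i j where ij: "i \<in> missed x \<inter> missed y \<inter> missed z" "j \<in> missed x \<inter> missed y \<inter> missed z" "i \<noteq> j"
    by (auto simp: card_2_iff)
  then have "\<not> i \<sim> x" "\<not> i \<sim> y" "\<not> i \<sim> z" "\<not> j \<sim> x" "\<not> j \<sim> y" "\<not> j \<sim> z" "i \<sim> j"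
    using missed_not_adj adj_A by auto
  then show False
    using no_P3_union_P2[OF assms(2,3,4) \<open>\<not> x \<sim> z\<close> \<open>i \<sim> j\<close>] not_adj_sym[of _ x] not_adj_sym[of _ y]
      not_adj_sym[of _ z] by simp
qed

text \<open>
  Otherwise \<open>y i j\<close> is an induced path with no edges to \<open>d\<close> and \<open>e\<close>. The condition \<open>y \<noteq> j\<close> excludes
  that \<open>y\<close> is itself the missed member of \<open>A\<close>.
\<close>

lemma adjacent_to_edge:
  assumes "d \<sim> e" "i \<in> missed d \<inter> missed e" "j \<in> missed d \<inter> missed e"
    and "i \<notin> missed y" "j \<in> missed y" "y \<noteq> j"
  shows "y \<sim> d \<or> y \<sim> e"
proof (rule ccontr)
  assume "\<not> ?thesis"
  then have "\<not> y \<sim> d" "\<not> y \<sim> e"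
    by auto
  moreover have "i \<in> A" "j \<in> A" "i \<noteq> j"
    using assms missed_not_adj by auto
  then have "y \<sim> i" "i \<sim> j"
    using assms(4) adj_A not_missed adj_sym by auto
  moreover have "\<not> y \<sim> j" "\<not> i \<sim> d" "\<not> i \<sim> e" "\<not> j \<sim> d" "\<not> j \<sim> e"
    using assms(2,3,5) missed_not_adj not_adj_sym by auto
  ultimately show False
    using no_P3_union_P2[of y i j d e] assms(1,6) by blast
qed

text \<open>
  Replacing \<open>S\<close> by \<open>Q\<close> in \<open>A\<close> yields another clique.
\<close>

lemma card_clique_class:
  assumes Q: "clique G Q" "\<And>x. x \<in> Q \<Longrightarrow> missed x = S" and S: "S \<subseteq> A"
  shows "card Q \<le> card S"
proof -
  have adj: "a \<sim> x" if "a \<in> A - S" "x \<in> Q" for a x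
    using that Q(2)[of x] not_missed by auto
  have disj: "Q \<inter> (A - S) = {}"
    using adj adj_irrefl by blast
  have "clique G (Q \<union> (A - S))"
    unfolding clique_def
  proof (intro conjI pairwiseI)
    show "Q \<union> (A - S) \<subseteq> verts G"
      using Q(1) A_verts by (auto simp: clique_def)
    fix x y assume xy: "x \<in> Q \<union> (A - S)" "y \<in> Q \<union> (A - S)" "x \<noteq> y"
    show "x \<sim> y"
    proof (cases "x \<in> Q"; cases "y \<in> Q")
      assume "x \<in> Q" "y \<in> Q"
      then show ?thesis
        using Q(1) xy(3) by (intro clique_adj)
    qed (use xy adj[of x y] adj[of y x] adj_sym[of y x] adj_A[of x y] in auto)
  qed
  then have "card (Q \<union> (A - S)) \<le> card A"
    by (rule card_clique_le)
  moreover have "card (Q \<union> (A - S)) = card Q + (card A - card S)"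
    using disj finite_clique[OF Q(1)] finite_A S
    by (simp add: card_Un_disjoint card_Diff_subset finite_subset)
  moreover have "card S \<le> card A"
    using finite_A S by (rule card_mono)
  ultimately show ?thesis
    by linarith
qed

lemma card_missed_edge:
  assumes "x \<sim> y" "missed x = missed y"
  shows "2 \<le> card (missed x)"
proof -
  have ne: "x \<noteq> y"
    using assms(1) adj_irrefl by auto
  have "clique G {x, y}"
    using assms(1) adj_sym[OF assms(1)] adj_in_verts[OF assms(1)]
    by (auto simp: clique_def pairwise_insert)
  then have "card {x, y} \<le> card (missed x)"
    using assms(2) missed_subset by (intro card_clique_class) auto
  then show ?thesis
    using ne by simp
qed

text \<open>
  An edge inside the class forces \<open>card S \<ge> 2\<close>; then the class contains no induced path on three
  vertices, and its cliques have at most \<open>card S\<close> elements.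
\<close>

lemma class_colorable:
  assumes "S \<subseteq> A"
  shows "colorable {x \<in> verts G. missed x = S} (card S)"
proof (rule P4_free_colorable)
  show "P4_free {x \<in> verts G. missed x = S}"
    unfolding P4_free_def
  proof (intro ballI impI)
    fix p q r s
    assume v: "p \<in> {x \<in> verts G. missed x = S}" "q \<in> {x \<in> verts G. missed x = S}"
      "r \<in> {x \<in> verts G. missed x = S}"
      and adj: "p \<sim> q" "q \<sim> r" "r \<sim> s"
    have "2 \<le> card (missed p \<inter> missed q \<inter> missed r)"
      using card_missed_edge[OF adj(1)] v by simp
    then show "p \<sim> r \<or> q \<sim> s \<or> p \<sim> s"
      using no_P3_missing_edge[OF _ adj(1,2)] adj(3) by blast
  qed
  show "card Q \<le> card S" if "clique G Q" "Q \<subseteq> {x \<in> verts G. missed x = S}" for Q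
    using that assms by (intro card_clique_class) auto
qed auto

lemma neighbourhood_P4_free: "P4_free {y. x \<sim> y}"
  unfolding P4_free_def using no_gem[of x] by blast

lemma card_clique_neighbourhood:
  assumes "x \<in> verts G" "clique G Q" "Q \<subseteq> {y. x \<sim> y}"
  shows "card Q + 1 \<le> card A"
proof -
  have "clique G (insert x Q)" "x \<notin> Q"
    using assms clique_insert[OF assms(2,1)] adj_irrefl by auto
  then show ?thesis
    using card_clique_le[of "insert x Q"] finite_clique[OF assms(2)] by simp
qed

lemma neighbourhood_colorable:
  assumes "x \<in> verts G"
  shows "colorable {y. x \<sim> y} (card A - 1)"
proof (rule P4_free_colorable)
  show "{y. x \<sim> y} \<subseteq> verts G"
    using adj_in_verts(2)[of x] by (intro subsetI) simp
  show "card Q \<le> card A - 1" if "clique G Q" "Q \<subseteq> {y. x \<sim> y}" for Q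
    using card_clique_neighbourhood[OF assms that] by simp
qed (rule neighbourhood_P4_free)

lemma closed_neighbourhood_colorable:
  assumes "x \<in> verts G"
  shows "colorable (insert x {y. x \<sim> y}) (card A)"
proof -
  have "colorable ({y. x \<sim> y} \<union> {x}) ((card A - 1) + 1)"
    using neighbourhood_colorable[OF assms] adj_irrefl
    by (intro colorable_Un colorable_independent) auto
  moreover have "1 \<le> card A"
    using card_clique_neighbourhood[OF assms, of "{}"] by (simp add: clique_def)
  ultimately show ?thesis
    by simp
qed

section \<open>Two kinds of sets that need few colours\<close>

text \<open>
  Each class is coloured with the elements of its own missed set, so that no two different classes
  with an edge between them share a colour.
\<close>

lemma laminar_colorable:
  assumes X: "X \<subseteq> verts G"
    and "\<And>x y. x \<in> X \<Longrightarrow> y \<in> X \<Longrightarrow> x \<sim> y \<Longrightarrow>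
      missed x = missed y \<or> missed x \<inter> missed y = {}"
  shows "colorable X (card A)"
proof -
  define proper where "proper S c \<longleftrightarrow> c ` {x \<in> verts G. missed x = S} \<subseteq> S \<and>
      (\<forall>x y. missed x = S \<longrightarrow> missed y = S \<longrightarrow> x \<sim> y \<longrightarrow> c x \<noteq> c y)" for S and c :: "'a \<Rightarrow> 'a"
  have "\<exists>c. proper S c" if S: "S \<subseteq> A" for S
  proof -
    obtain c where "c ` {x \<in> verts G. missed x = S} \<subseteq> S"
      and "\<And>x y. x \<in> {x \<in> verts G. missed x = S} \<Longrightarrow> y \<in> {x \<in> verts G. missed x = S} \<Longrightarrow>
        x \<sim> y \<Longrightarrow> c x \<noteq> c y"
      by (rule colorableE[OF class_colorable[OF S] finite_subset[OF S finite_A] refl])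
        (rule that)
    then have "proper S c"
      using adj_in_verts by (auto simp: proper_def)
    then show ?thesis
      by blast
  qed
  then have "\<forall>S. \<exists>c. S \<subseteq> A \<longrightarrow> proper S c"
    by blast
  from choice[OF this] obtain c where c: "\<And>S. S \<subseteq> A \<Longrightarrow> proper S (c S)"
    by blast
  have c_in: "c (missed x) x \<in> missed x" if "x \<in> X" for x
    using c[OF missed_subset[of x]] that X by (auto simp: proper_def)
  show ?thesis
  proof (rule colorableI[OF finite_A order_refl, of "\<lambda>x. c (missed x) x"])
    show "(\<lambda>x. c (missed x) x) ` X \<subseteq> A"
      using c_in missed_subset by blast
    fix x y assume xy: "x \<in> X" "y \<in> X" "x \<sim> y"
    show "c (missed x) x \<noteq> c (missed y) y"
    proof (cases "missed x = missed y")
      case True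
      then show ?thesis
        using c[OF missed_subset[of x]] xy(3) by (simp add: proper_def)
    next
      case False
      then have "missed x \<inter> missed y = {}"
        using assms(2)[OF xy] by blast
      then show ?thesis
        using c_in[OF xy(1)] c_in[OF xy(2)] by (metis disjoint_iff)
    qed
  qed
qed

text \<open>
  When two of the three missed sets are comparable, the intersection of all three is the
  intersection of two of them and therefore still contains two elements.
\<close>

lemma comparable_no_P3:
  assumes "\<And>u v. u \<in> X \<Longrightarrow> v \<in> X \<Longrightarrow> 2 \<le> card (missed u \<inter> missed v)"
    and X: "x \<in> X" "y \<in> X" "z \<in> X" and P3: "x \<sim> y" "y \<sim> z" "x \<noteq> z" "\<not> x \<sim> z"
    and comp: "missed x \<subseteq> missed y \<or> missed y \<subseteq> missed x \<or> missed x \<subseteq> missed z \<or>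
      missed z \<subseteq> missed x \<or> missed y \<subseteq> missed z \<or> missed z \<subseteq> missed y"
  shows False
proof -
  have "missed x \<inter> missed y \<inter> missed z \<in> {missed x \<inter> missed y, missed x \<inter> missed z, missed y \<inter> missed z}"
    using comp by blast
  then have "2 \<le> card (missed x \<inter> missed y \<inter> missed z)"
    using assms(1) X by auto
  then show False
    using no_P3_missing_edge P3 by blast
qed

text \<open>
  The closed neighbourhood of such a vertex \<open>x\<close> is a union of components of \<open>X\<close>. By \<open>comparable_no_P3\<close>
  the missed sets of an induced path \<open>x y z\<close> are pairwise incomparable, so \<open>missed x \<noteq> A\<close> and there is a
  neighbour \<open>w\<close> of \<open>x\<close> in the same class. Since \<open>missed x\<close> contains both an element missed by \<open>z\<close> and one not
  missed by \<open>z\<close>, \<open>z\<close> is adjacent to one end of the edge \<open>x w\<close>, and then to both.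
\<close>

lemma intersecting_closed_neighbourhood:
  assumes two: "\<And>u v. u \<in> X \<Longrightarrow> v \<in> X \<Longrightarrow> 2 \<le> card (missed u \<inter> missed v)"
    and X: "x \<in> X" "y \<in> X" "z \<in> X"
    and special: "missed x = A \<or> (\<exists>w\<in>X. x \<sim> w \<and> missed w = missed x)"
    and P3: "x \<sim> y" "y \<sim> z" "x \<noteq> z"
  shows "x \<sim> z"
proof (rule ccontr)
  assume nadj: "\<not> x \<sim> z"
  note no_P3 = comparable_no_P3[OF two]
  have incomp: "\<not> missed x \<subseteq> missed z" "\<not> missed z \<subseteq> missed x"
    using no_P3[OF _ _ X P3 nadj] by blast+
  then obtain w where w: "w \<in> X" "x \<sim> w" "missed w = missed x"
    using special missed_subset by blast
  have nwz: "\<not> w \<sim> z"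
    using no_P3[OF _ _ X(1) w(1) X(3) w(2) _ P3(3) nadj] w(3) by blast
  have "missed x \<inter> missed z \<noteq> {}"
    using two[OF X(1,3)] by auto
  then obtain i j where i: "i \<in> missed x" "i \<notin> missed z" and j: "j \<in> missed x" "j \<in> missed z"
    using incomp(1) by blast
  have "j \<in> A"
    using j missed_not_adj by auto
  then have "z \<noteq> j"
    using missed_member j(1) incomp(2) by auto
  then have "z \<sim> x \<or> z \<sim> w"
    using w i j by (intro adjacent_to_edge[of x w i j z]) auto
  then show False
    using nadj nwz adj_sym by blast
qed

text \<open>
  Components that consist of a closed neighbourhood are coloured by perfection of the
  neighbourhood. If none is left, two adjacent vertices have different missed sets, hence no common
  neighbour in \<open>A\<close>, and every vertex can be coloured by a neighbour in \<open>A\<close>.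
\<close>

lemma intersecting_colorable:
  assumes "X \<subseteq> verts G"
    and "\<And>u v. u \<in> X \<Longrightarrow> v \<in> X \<Longrightarrow> 2 \<le> card (missed u \<inter> missed v)"
  shows "colorable X (card A)"
  using finite_subset[OF assms(1) finite_verts] assms
proof (induction X rule: finite_psubset_induct)
  case (psubset X)
  note two = psubset.prems(2)
  show ?case
  proof (cases "\<exists>x\<in>X. missed x = A \<or> (\<exists>w\<in>X. x \<sim> w \<and> missed w = missed x)")
    case True
    then obtain x where x: "x \<in> X" and special: "missed x = A \<or> (\<exists>w\<in>X. x \<sim> w \<and> missed w = missed x)"
      by blast
    let ?N = "insert x {y. x \<sim> y}"
    have closed: "z \<in> ?N" if "y \<in> X \<inter> ?N" "z \<in> X" "y \<sim> z" for y z
      using intersecting_closed_neighbourhood[OF two x _ _ special] that by blast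
    have "colorable (X \<inter> ?N \<union> (X - ?N)) (card A)"
    proof (rule colorable_Un_anticomplete)
      show "colorable (X \<inter> ?N) (card A)"
        using closed_neighbourhood_colorable[OF subsetD[OF psubset.prems(1) x]]
        by (rule colorable_mono) auto
      show "colorable (X - ?N) (card A)"
      proof (rule psubset.IH)
        show "X - ?N \<subset> X" "X - ?N \<subseteq> verts G"
          using x psubset.prems(1) by auto
        show "2 \<le> card (missed u \<inter> missed v)" if "u \<in> X - ?N" "v \<in> X - ?N" for u v
          using two that by blast
      qed
      show "\<not> y \<sim> z" if "y \<in> X \<inter> ?N" "z \<in> X - ?N" for y z
        using closed that by blast
    qed
    then show ?thesis
      by (rule colorable_mono) auto
  next
    case False
    have "\<exists>a. a \<in> A - missed x" if "x \<in> X" for x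
      using False that missed_subset[of x] by blast
    then obtain c where c: "\<And>x. x \<in> X \<Longrightarrow> c x \<in> A - missed x"
      by metis
    show ?thesis
    proof (rule colorableI[OF finite_A order_refl, of c])
      show "c ` X \<subseteq> A"
        using c by blast
      fix x y assume xy: "x \<in> X" "y \<in> X" "x \<sim> y"
      show "c x \<noteq> c y"
      proof
        assume eq: "c x = c y"
        have "missed x \<union> missed y \<noteq> A"
          using c[OF xy(1)] c[OF xy(2)] eq by auto
        moreover have "missed x \<inter> missed y \<noteq> {}"
          using two[OF xy(1,2)] by auto
        ultimately have "missed y = missed x"
          using missed_adjacent[OF xy(3)] by simp
        then show False
          using False xy by blast
      qed
    qed
  qed
qed

end

section \<open>Clique numbers other than three\<close>

context P3_union_P2_gem_free_max_clique
begin

lemma card_missed_Int_ge_2: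
  assumes "missed x \<union> missed y \<noteq> A"
    and "card A + 1 \<le> 2 * card (missed x)" "card A + 1 \<le> 2 * card (missed y)"
  shows "2 \<le> card (missed x \<inter> missed y)"
proof -
  have "missed x \<union> missed y \<subset> A"
    using assms(1) missed_subset by blast
  then have "card (missed x \<union> missed y) < card A"
    using finite_A by (intro psubset_card_mono)
  then show ?thesis
    using card_Un_Int[OF finite_missed finite_missed, of x y] assms(2,3) by linarith
qed

text \<open>
  Two subsets of \<open>A\<close> with more than half of its elements intersect, and sets of equal size are not
  properly nested; so the gem-freeness conditions leave only equality as long as the union is not
  all of \<open>A\<close>.
\<close>

lemma half_missed_Un:
  assumes "2 * card (missed x) = card A + 1" "2 * card (missed y) = card A + 1"
    and "missed x \<noteq> missed y"
  shows "missed x \<union> missed y = A"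
proof (rule ccontr)
  assume union: "missed x \<union> missed y \<noteq> A"
  then have "missed x \<inter> missed y \<noteq> {}"
    using card_missed_Int_ge_2[OF union] assms(1,2) by auto
  then have "missed x \<subseteq> missed y \<or> missed y \<subseteq> missed x"
    using missed_adjacent[OF _ union] missed_nonadjacent[OF _ union] assms(3) by blast
  moreover have "card (missed x) = card (missed y)"
    using assms(1,2) by simp
  ultimately show False
    using assms(3) card_subset_eq[OF finite_missed] by metis
qed

text \<open>
  The complements are pairwise disjoint subsets of \<open>A\<close> of size \<open>(card A - 1) / 2\<close>.
\<close>

lemma three_half_missed:
  assumes "2 * card (missed x) = card A + 1" "2 * card (missed y) = card A + 1"
    "2 * card (missed z) = card A + 1"
    and "missed x \<noteq> missed y" "missed x \<noteq> missed z" "missed y \<noteq> missed z"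
  shows "card A \<le> 3"
proof -
  have "(A - missed x) \<inter> (A - missed y) = {}" "(A - missed x) \<inter> (A - missed z) = {}"
    "(A - missed y) \<inter> (A - missed z) = {}"
    using half_missed_Un assms by blast+
  then have "card ((A - missed x) \<union> (A - missed y) \<union> (A - missed z)) =
      card (A - missed x) + card (A - missed y) + card (A - missed z)"
    using finite_A by (subst card_Un_disjoint | blast | simp)+
  moreover have "card ((A - missed x) \<union> (A - missed y) \<union> (A - missed z)) \<le> card A"
    using finite_A by (intro card_mono) auto
  moreover have "card (A - missed v) = card A - card (missed v)" for v
    by (rule card_Diff_subset[OF finite_missed missed_subset])
  ultimately show ?thesis
    using assms(1-3) by simp
qed

text \<open>
  Sets of size at most half of \<open>card A\<close> with union \<open>A\<close> are disjoint, and this survives adding a single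
  set of size \<open>(card A + 1) / 2\<close>. By \<open>three_half_missed\<close>, at most one set of that size is then left on the
  large side, so two large sets intersect in at least two elements even when their union is \<open>A\<close>.
\<close>

lemma colorable_if_card_neq_3:
  assumes "card A \<noteq> 3"
  shows "colorable (verts G) (2 * card A)"
proof -
  let ?half = "\<lambda>x. 2 * card (missed x) = card A + 1"
  \<comment> \<open>The vertex x0 selects the class of half size that joins the small side, if there is one.\<close>
  obtain x0 where x0: "\<And>x. x \<in> verts G \<Longrightarrow> ?half x \<Longrightarrow> ?half x0"
    by blast
  define small where
    "small = {x \<in> verts G. 2 * card (missed x) \<le> card A \<or> ?half x \<and> missed x = missed x0}"
  define large where "large = verts G - small"
  have "colorable small (card A)"
  proof (rule laminar_colorable)
    show "small \<subseteq> verts G"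
      by (auto simp: small_def)
    fix x y assume xy: "x \<in> small" "y \<in> small" "x \<sim> y"
    show "missed x = missed y \<or> missed x \<inter> missed y = {}"
    proof (cases "missed x \<union> missed y = A \<and> missed x \<noteq> missed y")
      case True
      then have "card A = card (missed x \<union> missed y)"
        by simp
      moreover have "2 * card (missed x) + 2 * card (missed y) \<le> 2 * card A + 1"
        using xy(1,2) True by (auto simp: small_def)
      ultimately have "card (missed x \<inter> missed y) = 0"
        using card_Un_Int[OF finite_missed finite_missed, of x y] by linarith
      then show ?thesis
        using finite_missed by simp
    next
      case False
      then show ?thesis
        using missed_adjacent[OF xy(3)] by blast
    qed
  qed
  moreover have "colorable large (card A)"
  proof (rule intersecting_colorable)
    show "large \<subseteq> verts G"
      by (auto simp: large_def)
    fix u v assume uv: "u \<in> large" "v \<in> large"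
    then have V: "u \<in> verts G" "v \<in> verts G"
      and big: "card A + 1 \<le> 2 * card (missed u)" "card A + 1 \<le> 2 * card (missed v)"
      and neq: "?half u \<Longrightarrow> missed u \<noteq> missed x0" "?half v \<Longrightarrow> missed v \<noteq> missed x0"
      by (auto simp: large_def small_def)
    show "2 \<le> card (missed u \<inter> missed v)"
    proof (cases "missed u = missed v")
      case True
      have "card (missed u) \<noteq> 1"
      proof
        assume 1: "card (missed u) = 1"
        moreover have le: "card (missed u) \<le> card A"
          using finite_A missed_subset by (rule card_mono)
        ultimately have A: "card A = 1"
          using big(1) by linarith
        then have "?half u" "?half x0"
          using x0[OF V(1)] 1 by auto
        then have "missed u = A" "missed x0 = A"
          using A card_subset_eq[OF finite_A missed_subset] by auto
        then show False
          using neq(1) \<open>?half u\<close> by simp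
      qed
      then show ?thesis
        using True big(1) missed_nonempty[OF V(1)] finite_missed[of u]
        by (cases "card (missed u) = 0") auto
    next
      case False
      show ?thesis
      proof (cases "missed u \<union> missed v = A")
        case union: True
        have "\<not> (?half u \<and> ?half v)"
        proof
          assume half: "?half u \<and> ?half v"
          then have "card A \<le> 3"
            using three_half_missed[of u v x0] x0[OF V(1)] neq False by blast
          moreover have "odd (card A)"
            using half by presburger
          ultimately have "card A = 1"
            using assms by presburger
          then have "missed u = A" "missed v = A"
            using half card_subset_eq[OF finite_A missed_subset] by auto
          then show False
            using False by simp
        qed
        then have "2 * card A + 3 \<le> 2 * card (missed u) + 2 * card (missed v)"
          using big by linarith
        then show ?thesis
          using card_Un_Int[OF finite_missed finite_missed, of u v] union by simp
      next
        case False
        then show ?thesis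
          using card_missed_Int_ge_2 big by blast
      qed
    qed
  qed
  ultimately have "colorable (small \<union> large) (card A + card A)"
    by (rule colorable_Un)
  then show ?thesis
    by (rule colorable_mono) (auto simp: large_def)
qed

end

section \<open>Clique number three\<close>

text \<open>
  With three elements in \<open>A\<close>, a vertex misses one member, is attached to a single member, or is remote
  from all of them.
\<close>

locale P3_union_P2_gem_free_triangle = P3_union_P2_gem_free_max_clique +
  assumes card_A_3: "card A = 3"
begin

definition missing :: "'a \<Rightarrow> 'a set" where
  "missing k = {x \<in> verts G. missed x = {k}}"

definition attached :: "'a \<Rightarrow> 'a set" where
  "attached k = {x \<in> verts G. missed x = A - {k}}"

definition remote :: "'a set" where
  "remote = {x \<in> verts G. missed x = A}"

lemma third_member:
  assumes "k \<in> A" "j \<in> A" "k \<noteq> j"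
  obtains l where "l \<in> A" "l \<noteq> k" "l \<noteq> j" "A = {k, j, l}"
proof -
  have "card (A - {k, j}) = 1"
    using assms card_A_3 by (simp add: card_Diff_subset)
  then obtain l where "A - {k, j} = {l}"
    by (auto simp: card_1_singleton_iff)
  then have "l \<in> A" "l \<noteq> k" "l \<noteq> j" "A = {k, j, l}"
    using assms by auto
  then show thesis
    by (rule that)
qed

lemma card_A_Diff: "k \<in> A \<Longrightarrow> card (A - {k}) = 2"
  using card_A_3 finite_A by simp

lemma class_cases:
  assumes "x \<in> verts G"
  obtains (missing) k where "k \<in> A" "x \<in> missing k"
    | (attached) k where "k \<in> A" "x \<in> attached k"
    | (remote) "x \<in> remote"
proof -
  have le: "card (missed x) \<le> 3" and pos: "card (missed x) \<noteq> 0"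
    using card_mono[OF finite_A missed_subset] card_A_3 missed_nonempty[OF assms] finite_missed
    by auto
  have diff: "card (A - missed x) = 3 - card (missed x)"
    using card_Diff_subset[OF finite_missed missed_subset] card_A_3 by simp
  consider "card (missed x) = 1" | "card (missed x) = 2" | "card (missed x) = 3"
    using le pos by linarith
  then show thesis
  proof cases
    case 1
    then obtain k where k: "missed x = {k}"
      by (auto simp: card_1_singleton_iff)
    then have "k \<in> A"
      using missed_subset[of x] by auto
    then show thesis
      using assms k by (intro that(1)[of k]) (auto simp: missing_def)
  next
    case 2
    then have "card (A - missed x) = 1"
      using diff by simp
    then obtain k where k: "A - missed x = {k}"
      by (auto simp: card_1_singleton_iff)
    then have "k \<in> A" "missed x = A - {k}"
      using missed_subset[of x] by auto
    then show thesis
      using assms by (intro that(2)[of k]) (auto simp: attached_def)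
  next
    case 3
    then have "missed x = A"
      using card_subset_eq[OF finite_A missed_subset] card_A_3 by simp
    then show thesis
      using assms by (intro that(3)) (auto simp: remote_def)
  qed
qed

lemma no_K4:
  assumes "a \<sim> b" "a \<sim> c" "a \<sim> d" "b \<sim> c" "b \<sim> d" "c \<sim> d"
  shows False
proof -
  have "clique G {a, b, c, d}"
    using assms assms[THEN adj_sym] assms(1,2,3)[THEN adj_in_verts(2)] adj_in_verts(1)[OF assms(1)]
    by (auto simp: clique_def pairwise_insert)
  then have "card {a, b, c, d} \<le> 3"
    using card_clique_le card_A_3 by metis
  moreover have "distinct [a, b, c, d]"
    using assms adj_irrefl by auto
  then have "card (set [a, b, c, d]) = 4"
    by (simp only: distinct_card) simp
  ultimately show False
    by simp
qed

lemma missing_colorable: "colorable (\<Union>k\<in>A. missing k) 3"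
proof -
  have "colorable (\<Union>k\<in>A. missing k) (card A)"
    by (rule laminar_colorable) (auto simp: missing_def)
  then show ?thesis
    by (simp only: card_A_3)
qed

lemma attached_not_member:
  assumes "k \<in> A" "s \<in> attached k" "a \<in> A"
  shows "s \<noteq> a"
proof
  assume "s = a"
  then have "A - {k} = {a}"
    using missed_member[OF assms(3)] assms(2) by (simp add: attached_def)
  then show False
    using card_A_Diff[OF assms(1)] by simp
qed

lemma remote_attached_no_P3:
  assumes "k \<in> A" "x \<in> remote \<union> attached k" "y \<in> remote \<union> attached k" "z \<in> remote \<union> attached k"
    and "x \<sim> y" "y \<sim> z" "x \<noteq> z"
  shows "x \<sim> z"
proof (rule no_P3_missing_edge[OF _ assms(5-7)])
  have "A - {k} \<subseteq> missed x \<inter> missed y \<inter> missed z"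
    using assms(2-4) by (auto simp: remote_def attached_def)
  then show "2 \<le> card (missed x \<inter> missed y \<inter> missed z)"
    using card_A_Diff[OF assms(1)] card_mono[of "missed x \<inter> missed y \<inter> missed z" "A - {k}"]
      finite_missed by simp
qed

text \<open>
  The third member \<open>c\<close> of \<open>A\<close> is missed by \<open>s\<close>, \<open>d\<close> and \<open>e\<close>, while \<open>a\<close> is missed only by \<open>d\<close> and \<open>e\<close>.
\<close>

lemma attached_touches_edge:
  assumes "a \<in> A" "b \<in> A" "a \<noteq> b" and s: "s \<in> attached a"
    and de: "d \<sim> e" "d \<in> remote \<union> attached b" "e \<in> remote \<union> attached b"
  shows "s \<sim> d \<or> s \<sim> e"
proof -
  obtain c where c: "c \<in> A" "c \<noteq> a" "c \<noteq> b"
    using third_member[OF assms(1-3)] by metis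
  show ?thesis
  proof (rule adjacent_to_edge[OF de(1), of a c])
    show "a \<in> missed d \<inter> missed e" "c \<in> missed d \<inter> missed e"
      using de(2,3) assms(1-3) c by (auto simp: remote_def attached_def)
    show "a \<notin> missed s" "c \<in> missed s"
      using s c by (auto simp: attached_def)
    show "s \<noteq> c"
      using attached_not_member[OF assms(1) s c(1)] .
  qed
qed

lemma missing_attached_not_adj:
  assumes "i \<in> A" "k \<in> A" "i \<noteq> k" "y \<in> missing i" "w \<in> attached k"
  shows "\<not> y \<sim> w"
proof
  assume adj: "y \<sim> w"
  have m: "missed y = {i}" "missed w = A - {k}"
    using assms by (auto simp: missing_def attached_def)
  have "missed y \<union> missed w \<noteq> A" "missed y \<inter> missed w \<noteq> {}"
    using assms(1-3) by (auto simp: m)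
  then have "{i} = A - {k}"
    using missed_adjacent[OF adj] m by auto
  then show False
    using card_A_Diff[OF assms(2)] by (metis card_1_singleton_iff numeral_eq_one_iff semiring_norm(85) One_nat_def)
qed

text \<open>
  The edge \<open>z w\<close> misses \<open>i\<close> and the third member \<open>j\<close>, and \<open>y\<close> is adjacent to \<open>j\<close> but not to \<open>i\<close>; so \<open>y\<close> is
  adjacent to \<open>z\<close> or to \<open>w\<close>, and \<open>w\<close> is excluded.
\<close>

lemma missing_adj_remote:
  assumes "i \<in> A" "k \<in> A" "i \<noteq> k" and y: "y \<in> missing i" "y \<noteq> i"
    and z: "z \<in> remote" "w \<in> attached k" "z \<sim> w"
  shows "z \<sim> y"
proof -
  obtain j where j: "j \<in> A" "j \<noteq> i" "j \<noteq> k"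
    using third_member[OF assms(1-3)] by metis
  have "y \<sim> z \<or> y \<sim> w"
  proof (rule adjacent_to_edge[OF z(3), of j i])
    show "j \<in> missed z \<inter> missed w" "i \<in> missed z \<inter> missed w"
      using z j assms(1-3) by (auto simp: remote_def attached_def)
    show "j \<notin> missed y" "i \<in> missed y" "y \<noteq> i"
      using y j by (auto simp: missing_def)
  qed
  then show ?thesis
    using missing_attached_not_adj[OF assms(1-3) y(1) z(2)] adj_sym by blast
qed

text \<open>
  The vertices \<open>a\<close> and \<open>b\<close> are adjacent because their missed sets are incomparable, and with the third
  member \<open>k\<close> of \<open>A\<close> the path \<open>i k a z\<close> in the neighbourhood of \<open>b\<close> completes a gem.
\<close>

lemma remote_not_adj_two_missing:
  assumes "i \<in> A" "j \<in> A" "i \<noteq> j" and a: "a \<in> missing i" "a \<noteq> i" and b: "b \<in> missing j" "b \<noteq> j"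
    and z: "z \<in> remote" "z \<sim> a" "z \<sim> b"
  shows False
proof -
  obtain k where k: "k \<in> A" "k \<noteq> i" "k \<noteq> j"
    using third_member[OF assms(1-3)] by metis
  have m: "missed a = {i}" "missed b = {j}" "missed z = A"
    using a b z by (auto simp: missing_def remote_def)
  have "a \<sim> b"
  proof (rule ccontr)
    assume "\<not> a \<sim> b"
    then have "missed a \<subseteq> missed b \<or> missed b \<subseteq> missed a"
      using k m by (intro missed_nonadjacent) auto
    then show False
      using m assms(3) by simp
  qed
  moreover have "i \<sim> b" "k \<sim> b" "k \<sim> a" "i \<sim> k" "\<not> i \<sim> a" "\<not> i \<sim> z" "\<not> k \<sim> z"
    using m k assms(1-3) adj_A not_missed missed_not_adj(1)[of i a] missed_not_adj(1)[of _ z] by auto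
  ultimately show False
    using no_gem[of b i k a z] z adj_sym by blast
qed

text \<open>
  A remote vertex \<open>z\<close> with neighbours in all three attached classes is adjacent to every vertex outside
  \<open>A\<close> that misses just one member, but it tolerates such vertices in one class only.
\<close>

lemma at_most_one_large_missing:
  assumes z: "z \<in> remote" and hit: "\<And>k. k \<in> A \<Longrightarrow> \<exists>w\<in>attached k. z \<sim> w"
  shows "\<exists>k0. \<forall>i\<in>A. i \<noteq> k0 \<longrightarrow> missing i \<subseteq> {i}"
proof (rule ccontr)
  assume none: "\<not> ?thesis"
  then obtain i where i: "i \<in> A" "\<not> missing i \<subseteq> {i}"
    by blast
  moreover obtain j where j: "j \<in> A" "i \<noteq> j" "\<not> missing j \<subseteq> {j}"
    using none by blast
  ultimately obtain a b where a: "a \<in> missing i" "a \<noteq> i" and b: "b \<in> missing j" "b \<noteq> j"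
    by blast
  obtain w where w: "w \<in> attached i" "z \<sim> w"
    using hit i by blast
  obtain w' where w': "w' \<in> attached j" "z \<sim> w'"
    using hit j by blast
  have "z \<sim> a"
    using missing_adj_remote[OF i(1) j(1,2) a z w'] .
  moreover have "z \<sim> b"
    using missing_adj_remote[OF j(1) i(1) j(2)[symmetric] b z w] .
  ultimately show False
    using remote_not_adj_two_missing[OF i(1) j(1,2) a b z] by blast
qed

text \<open>
  A vertex \<open>v\<close> of \<open>attached j\<close> not adjacent to \<open>z\<close> is adjacent to both ends of the edge \<open>w w'\<close>, because each
  of the edges \<open>z w\<close> and \<open>z w'\<close> has to be touched. Moreover \<open>u\<close> is adjacent to exactly one end, say \<open>p\<close>, as
  both ends would give a \<open>K\<^sub>4\<close>. With \<open>q\<close> the other end, \<open>u z q v\<close> is an induced path in the neighbourhood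
  of \<open>p\<close>.
\<close>

lemma attached_subset_neighbourhood:
  assumes "k \<in> A" "j \<in> A" "j \<noteq> k" and z: "z \<in> remote"
    and w: "w \<in> attached k" "w' \<in> attached k" "w \<sim> w'" "z \<sim> w" "z \<sim> w'"
    and u: "u \<in> attached j" "z \<sim> u"
  shows "attached j \<subseteq> {y. z \<sim> y}"
proof
  fix v assume v: "v \<in> attached j"
  show "v \<in> {y. z \<sim> y}"
  proof (rule ccontr)
    assume "v \<notin> {y. z \<sim> y}"
    then have nzv: "\<not> z \<sim> v" "\<not> v \<sim> z"
      using adj_sym by auto
    have "v \<sim> w" "v \<sim> w'"
      using attached_touches_edge[OF assms(2,1,3) v] z w nzv by blast+
    have nuv: "\<not> u \<sim> v"
    proof
      assume "u \<sim> v"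
      then have "z \<sim> v \<or> z = v"
        using remote_attached_no_P3[OF assms(2), of z u v] z u v by blast
      then show False
        using nzv z v card_A_Diff[OF assms(2)] card_A_3 by (auto simp: remote_def attached_def)
    qed
    have gem: False if "p \<sim> q" "z \<sim> p" "z \<sim> q" "v \<sim> p" "v \<sim> q" "u \<sim> p" for p q
    proof -
      have "\<not> u \<sim> q"
        using no_K4[of z u p q] that u(2) by blast
      then show False
        using no_gem[of p u z q v] that u(2) nuv nzv adj_sym by blast
    qed
    have "u \<sim> w \<or> u \<sim> w'"
      using attached_touches_edge[OF assms(2,1,3) u(1) w(3)] w by blast
    then show False
      using gem[of w w'] gem[of w' w] w \<open>v \<sim> w\<close> \<open>v \<sim> w'\<close> adj_sym by blast
  qed
qed

text \<open>
  Both ends of an edge between remote vertices are adjacent to all attached vertices. If there are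
  attached vertices, it follows that the attached vertices together with all remote ones other than
  \<open>z\<close> and \<open>z'\<close> are independent, for otherwise there is a \<open>K\<^sub>4\<close>.
\<close>

lemma remote_edge_colorable:
  assumes z: "z \<in> remote" "z' \<in> remote" "z \<sim> z'"
  shows "colorable (remote \<union> (\<Union>k\<in>A. attached k)) 3"
proof (cases "(\<Union>k\<in>A. attached k) = {}")
  case True
  then show ?thesis
    using class_colorable[of A] card_A_3 by (simp add: remote_def)
next
  case False
  have complete: "t \<sim> s \<and> t' \<sim> s"
    if "t \<in> remote" "t' \<in> remote" "t \<sim> t'" "a \<in> A" "s \<in> attached a" for t t' a s
  proof -
    have "A - {a} \<noteq> {}"
      using card_A_Diff[OF that(4)] by (metis card.empty zero_neq_numeral)
    then obtain b where b: "b \<in> A" "a \<noteq> b"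
      by blast
    have "s \<sim> t \<or> s \<sim> t'"
      using attached_touches_edge[OF that(4) b that(5,3)] that(1,2) by blast
    moreover have "s \<noteq> t" "s \<noteq> t'"
      using that card_A_Diff[OF that(4)] card_A_3 by (auto simp: remote_def attached_def)
    ultimately show ?thesis
      using remote_attached_no_P3[OF that(4), of s t t'] remote_attached_no_P3[OF that(4), of s t' t]
        that adj_sym by blast
  qed
  obtain a u where u: "a \<in> A" "u \<in> attached a"
    using False by blast
  let ?I = "(remote - {z, z'}) \<union> (\<Union>k\<in>A. attached k)"
  have not_attached: "\<not> t \<sim> s" if t: "t \<in> remote - {z, z'}" and s: "b \<in> A" "s \<in> attached b" for t b s
  proof
    assume ts: "t \<sim> s"
    have zs: "z \<sim> s" "z' \<sim> s"
      using complete[OF z s] by auto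
    then have "t \<sim> z" "t \<sim> z'"
      using remote_attached_no_P3[OF s(1), of t s z] remote_attached_no_P3[OF s(1), of t s z']
        t ts s z adj_sym by auto
    then show False
      using no_K4[of t z z' s] zs z ts by blast
  qed
  have "\<not> x \<sim> y" if "x \<in> ?I" "y \<in> ?I" for x y
  proof
    assume xy: "x \<sim> y"
    consider "x \<in> remote - {z, z'}" "y \<in> remote - {z, z'}"
      | "x \<in> (\<Union>k\<in>A. attached k)" "y \<in> (\<Union>k\<in>A. attached k)"
      | "x \<in> remote - {z, z'}" "y \<in> (\<Union>k\<in>A. attached k)"
      | "y \<in> remote - {z, z'}" "x \<in> (\<Union>k\<in>A. attached k)"
      using \<open>x \<in> ?I\<close> \<open>y \<in> ?I\<close> by blast
    then show False
    proof cases
      case 1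
      then show False
        using complete[of x y a u] not_attached[of x a u] u xy by blast
    next
      case 2
      then obtain b d where "b \<in> A" "x \<in> attached b" "d \<in> A" "y \<in> attached d"
        by blast
      then show False
        using complete[OF z, of b x] complete[OF z, of d y] no_K4[of z z' x y] z(3) xy by blast
    next
      case 3
      then show False
        using not_attached xy by blast
    next
      case 4
      then show False
        using not_attached adj_sym[OF xy] by blast
    qed
  qed
  then have "colorable ?I 1"
    by (rule colorable_independent)
  moreover have "colorable {z} 1" "colorable {z'} 1"
    by (rule colorable_independent, simp add: adj_irrefl)+
  ultimately have "colorable ({z} \<union> {z'} \<union> ?I) (1 + 1 + 1)"
    by (intro colorable_Un)
  then show ?thesis
    by (rule colorable_mono) auto
qed

text \<open>
  The six colours are pairs of a member of \<open>A\<close> and a truth value. The class \<open>attached k\<close> uses the two colours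
  with first component \<open>k\<close>. Nothing in \<open>missing k\<close> is adjacent to \<open>attached j\<close> for \<open>j \<noteq> k\<close>, so \<open>missing k\<close> can
  use a colour of another attached class, chosen by a cyclic shift \<open>\<sigma>\<close>; this leaves the colours with
  second component \<open>False\<close> free of such vertices.
  
  As the remote vertices are independent, it suffices to find a colour for each of them that is absent
  from its neighbourhood. If \<open>z\<close> has no neighbour in some \<open>attached k\<close>, the colour \<open>(k, False)\<close> is available.
  Otherwise only one class \<open>missing k0\<close> can contain neighbours of \<open>z\<close>. If two of the attached classes
  contained an edge in the neighbourhood of \<open>z\<close>, then \<open>z\<close> would be adjacent to all attached vertices by
  \<open>attached_subset_neighbourhood\<close>; so for two members \<open>k\<close> of \<open>A\<close> there is just one neighbour in \<open>attached k\<close>,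
  and for one of them the colours of \<open>attached k\<close> are not used by \<open>missing k0\<close>. The colour of \<open>attached k\<close>
  different from that of the single neighbour is available.
\<close>

lemma six_colorable_generic:
  assumes indep: "\<And>x y. x \<in> remote \<Longrightarrow> y \<in> remote \<Longrightarrow> \<not> x \<sim> y"
    and no_dominating: "\<And>z. z \<in> remote \<Longrightarrow> \<not> (\<Union>k\<in>A. attached k) \<subseteq> {y. z \<sim> y}"
  shows "colorable (verts G) 6"
proof -
  obtain p q r where A: "A = {p, q, r}" and pqr: "p \<noteq> q" "p \<noteq> r" "q \<noteq> r"
    using card_A_3 by (auto simp: card_3_iff)
  define \<sigma> where "\<sigma> = (\<lambda>i. if i = p then q else if i = q then r else p)"
  have \<sigma>: "\<sigma> i \<in> A" "\<sigma> i \<noteq> i" for i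
    using A pqr by (auto simp: \<sigma>_def)
  have \<sigma>_inj: "\<sigma> i \<noteq> \<sigma> j" if "i \<in> A" "j \<in> A" "i \<noteq> j" for i j
    using that A pqr by (auto simp: \<sigma>_def)
  have "\<exists>c. \<forall>x\<in>attached k. \<forall>y\<in>attached k. x \<sim> y \<longrightarrow> c x \<noteq> (c y :: bool)" if "k \<in> A" for k
  proof -
    have "colorable (attached k) 2"
      using class_colorable[of "A - {k}"] card_A_Diff[OF that] by (simp add: attached_def)
    then show ?thesis
      by (rule colorableE[of _ _ "UNIV :: bool set"]) auto
  qed
  then have "\<forall>k\<in>A. \<exists>c. \<forall>x\<in>attached k. \<forall>y\<in>attached k. x \<sim> y \<longrightarrow> c x \<noteq> (c y :: bool)"
    by blast
  from bchoice[OF this] obtain c where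
    "\<forall>k\<in>A. \<forall>x\<in>attached k. \<forall>y\<in>attached k. x \<sim> y \<longrightarrow> c k x \<noteq> (c k y :: bool)"
    by (elim exE)
  then have c: "c k x \<noteq> c k y" if "k \<in> A" "x \<in> attached k" "y \<in> attached k" "x \<sim> y" for k x y
    using that by simp
  let ?free = "\<lambda>z jb. jb \<in> A \<times> UNIV \<and> (\<forall>x\<in>attached (fst jb). z \<sim> x \<longrightarrow> c (fst jb) x \<noteq> snd jb) \<and>
    (\<forall>i\<in>A. \<forall>x\<in>missing i. z \<sim> x \<longrightarrow> jb \<noteq> (\<sigma> i, True))"
  have "\<exists>jb. ?free z jb" if z: "z \<in> remote" for z
  proof (cases "\<exists>k\<in>A. \<forall>w\<in>attached k. \<not> z \<sim> w")
    case True
    then obtain k where "k \<in> A" "\<forall>w\<in>attached k. \<not> z \<sim> w"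
      by blast
    then show ?thesis
      by (intro exI[of _ "(k, False)"]) auto
  next
    case False
    then have hit: "\<exists>w\<in>attached k. z \<sim> w" if "k \<in> A" for k
      using that by blast
    obtain k0 where k0: "\<And>i. i \<in> A \<Longrightarrow> i \<noteq> k0 \<Longrightarrow> missing i \<subseteq> {i}"
      using at_most_one_large_missing[OF z hit] by blast
    have "\<exists>k\<in>A - {\<sigma> k0}. \<forall>w\<in>attached k. \<forall>w'\<in>attached k. z \<sim> w \<longrightarrow> z \<sim> w' \<longrightarrow> \<not> w \<sim> w'"
    proof (rule ccontr)
      assume "\<not> ?thesis"
      then have edge: "\<exists>w\<in>attached k. \<exists>w'\<in>attached k. z \<sim> w \<and> z \<sim> w' \<and> w \<sim> w'"
        if "k \<in> A" "k \<noteq> \<sigma> k0" for k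
        using that by blast
      have "attached j \<subseteq> {y. z \<sim> y}" if j: "j \<in> A" for j
      proof -
        have "\<not> A \<subseteq> {j, \<sigma> k0}"
          using card_mono[of "{j, \<sigma> k0}" A] card_A_3 card_insert_le_m1[of 2 "{\<sigma> k0}" j] by auto
        then obtain k where k: "k \<in> A" "j \<noteq> k" "k \<noteq> \<sigma> k0"
          by blast
        then show ?thesis
          using edge[OF k(1,3)] hit[OF j] attached_subset_neighbourhood[OF k(1) j k(2) z] by blast
      qed
      then show False
        using no_dominating[OF z] by blast
    qed
    then obtain k where k: "k \<in> A" "k \<noteq> \<sigma> k0"
      and no_edge: "\<And>w w'. w \<in> attached k \<Longrightarrow> w' \<in> attached k \<Longrightarrow> z \<sim> w \<Longrightarrow> z \<sim> w' \<Longrightarrow> \<not> w \<sim> w'"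
      by blast
    obtain u where u: "u \<in> attached k" "z \<sim> u"
      using hit[OF k(1)] by blast
    have single: "x = u" if x: "x \<in> attached k" "z \<sim> x" for x
    proof (rule ccontr)
      assume "x \<noteq> u"
      then have "x \<sim> u"
        using remote_attached_no_P3[OF k(1), of x z u] x u z adj_sym by blast
      then show False
        using no_edge x u by blast
    qed
    have "i = k0" if "i \<in> A" "x \<in> missing i" "z \<sim> x" for i x
    proof (rule ccontr)
      assume "i \<noteq> k0"
      then have "x = i"
        using k0 that by blast
      then show False
        using that(1,3) z adj_sym missed_not_adj(1)[of i z] by (simp add: remote_def)
    qed
    then show ?thesis
      using k single by (intro exI[of _ "(k, \<not> c k u)"]) auto
  qed
  then have "\<forall>z\<in>remote. \<exists>jb. ?free z jb"
    by blast
  from bchoice[OF this] obtain d where "\<forall>z\<in>remote. ?free z (d z)"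
    by (elim exE)
  then have d: "?free z (d z)" if "z \<in> remote" for z
    using that by (rule bspec)
  define col where "col x =
    (if missed x = A then d x
     else if card (missed x) = 1 then (\<sigma> (the_elem (missed x)), True)
     else (the_elem (A - missed x), c (the_elem (A - missed x)) x))" for x
  have ne: "{k} \<noteq> A" "A - {k} \<noteq> A" "card (A - {k}) \<noteq> 1" "A - (A - {k}) = {k}" if "k \<in> A" for k
    using that card_A_Diff[OF that] card_A_3 by auto
  have col_missing: "col x = (\<sigma> k, True)" if "k \<in> A" "x \<in> missing k" for k x
    using that ne(1)[OF that(1)] by (simp add: col_def missing_def)
  have col_attached: "col x = (k, c k x)" if "k \<in> A" "x \<in> attached k" for k x
    using that ne(2-4)[OF that(1)] by (simp add: col_def attached_def)
  have col_remote: "col x = d x" if "x \<in> remote" for x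
    using that by (simp add: col_def remote_def)
  have MM: "col x \<noteq> col y" if "i \<in> A" "x \<in> missing i" "j \<in> A" "y \<in> missing j" "x \<sim> y" for i j x y
  proof -
    have "i \<noteq> j"
      using card_missed_edge[OF that(5)] that(2,4) by (auto simp: missing_def)
    then show ?thesis
      using that col_missing \<sigma>_inj by simp
  qed
  have MA: "col x \<noteq> col y" if "i \<in> A" "x \<in> missing i" "k \<in> A" "y \<in> attached k" "x \<sim> y" for i k x y
  proof -
    have "i = k"
      using missing_attached_not_adj that by blast
    then show ?thesis
      using that col_missing col_attached \<sigma>(2)[of k] by simp
  qed
  have MR: "col z \<noteq> col x" if "i \<in> A" "x \<in> missing i" "z \<in> remote" "z \<sim> x" for i x z
    using that d[OF that(3)] col_missing[OF that(1,2)] col_remote[OF that(3)] by auto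
  have AA: "col x \<noteq> col y" if "k \<in> A" "x \<in> attached k" "j \<in> A" "y \<in> attached j" "x \<sim> y" for k j x y
  proof
    assume "col x = col y"
    then have "k = j \<and> c k x = c j y"
      unfolding col_attached[OF that(1,2)] col_attached[OF that(3,4)] prod.inject .
    then show False
      using c[OF that(1,2) _ that(5)] that(4) by blast
  qed
  have AR: "col z \<noteq> col x" if "k \<in> A" "x \<in> attached k" "z \<in> remote" "z \<sim> x" for k x z
  proof
    assume "col z = col x"
    then have dz: "d z = (k, c k x)"
      using col_attached[OF that(1,2)] col_remote[OF that(3)] by metis
    have "\<forall>w\<in>attached k. z \<sim> w \<longrightarrow> c k w \<noteq> c k x"
      using d[OF that(3), THEN conjunct2, THEN conjunct1] unfolding dz fst_conv snd_conv .
    then show False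
      using that(2,4) by blast
  qed
  show ?thesis
  proof (rule colorableI[of "A \<times> (UNIV :: bool set)" _ col])
    show "finite (A \<times> (UNIV :: bool set))" "card (A \<times> (UNIV :: bool set)) \<le> 6"
      using finite_A card_A_3 by (auto simp: card_cartesian_product)
    show "col ` verts G \<subseteq> A \<times> UNIV"
    proof
      fix y assume "y \<in> col ` verts G"
      then obtain x where x: "x \<in> verts G" "y = col x"
        by blast
      from x(1) have "col x \<in> A \<times> UNIV"
      proof (cases rule: class_cases)
        case (missing k)
        then show ?thesis
          using col_missing[OF missing] \<sigma>(1) by simp
      next
        case (attached k)
        then show ?thesis
          using col_attached[OF attached] by simp
      next
        case remote
        then show ?thesis
          using col_remote[OF remote] d[OF remote] by simp
      qed
      then show "y \<in> A \<times> UNIV"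
        using x(2) by simp
    qed
    fix x y assume xy: "x \<in> verts G" "y \<in> verts G" "x \<sim> y"
    note yx = adj_sym[OF xy(3)]
    from xy(1) show "col x \<noteq> col y"
    proof (cases rule: class_cases)
      case (missing i)
      from xy(2) show ?thesis
        using MM[OF missing _ _ xy(3)] MA[OF missing _ _ xy(3)] MR[OF missing _ yx, symmetric]
        by (cases rule: class_cases) blast+
    next
      case (attached k)
      from xy(2) show ?thesis
        using MA[OF _ _ attached yx, symmetric] AA[OF attached _ _ xy(3)] AR[OF attached _ yx, symmetric]
        by (cases rule: class_cases) blast+
    next
      case remote
      from xy(2) show ?thesis
        using MR[OF _ _ remote xy(3)] AR[OF _ _ remote xy(3)] indep[OF remote _] xy(3)
        by (cases rule: class_cases) blast+
    qed
  qed
qed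

text \<open>
  The vertices that miss one member of \<open>A\<close> always take three colours. If a remote vertex \<open>z\<close> is
  adjacent to all attached vertices, these lie in the bipartite neighbourhood of \<open>z\<close>, and independent
  remote vertices need just one more colour.
\<close>

lemma six_colorable: "colorable (verts G) 6"
proof -
  let ?U = "\<Union>k\<in>A. attached k"
  have cover: "verts G \<subseteq> (\<Union>k\<in>A. missing k) \<union> (remote \<union> ?U)"
  proof
    fix x assume "x \<in> verts G"
    then show "x \<in> (\<Union>k\<in>A. missing k) \<union> (remote \<union> ?U)"
      by (cases rule: class_cases) auto
  qed
  have reduce: ?thesis if "colorable (remote \<union> ?U) 3"
    using colorable_Un[OF missing_colorable that] cover by (rule colorable_mono) simp
  show ?thesis
  proof (cases "\<exists>z\<in>remote. \<exists>z'\<in>remote. z \<sim> z'")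
    case True
    then show ?thesis
      using remote_edge_colorable reduce by blast
  next
    case False
    then have indep: "\<And>x y. x \<in> remote \<Longrightarrow> y \<in> remote \<Longrightarrow> \<not> x \<sim> y"
      by blast
    show ?thesis
    proof (cases "\<exists>z\<in>remote. ?U \<subseteq> {y. z \<sim> y}")
      case True
      then obtain z where z: "z \<in> remote" "?U \<subseteq> {y. z \<sim> y}"
        by blast
      have "colorable {y. z \<sim> y} (card A - 1)"
        using z(1) by (intro neighbourhood_colorable) (simp add: remote_def)
      then have "colorable ?U 2"
        using z(2) by (rule colorable_mono) (simp add: card_A_3)
      then have "colorable (remote \<union> ?U) (1 + 2)"
        using colorable_independent[OF indep] by (intro colorable_Un)
      then have "colorable (remote \<union> ?U) 3"
        by (rule colorable_mono) auto
      then show ?thesis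
        by (rule reduce)
    next
      case False
      then show ?thesis
        using six_colorable_generic indep by blast
    qed
  qed
qed

end

theorem theorem3p4:
  fixes G :: "('a, 'b) pre_digraph"
  assumes "graph G"
    and "free_of {with_proj P3_union_P2, with_proj gem} G"
  shows "\<chi> G \<le> 2 * \<omega> G"
proof -
  interpret graph G by fact
  obtain A where A: "clique G A" "card A = \<omega> G"
    using clique_number_clique by blast
  interpret P3_union_P2_gem_free_max_clique G A
    using assms(2) A by unfold_locales
  have "colorable (verts G) (2 * \<omega> G)"
  proof (cases "\<omega> G = 3")
    case True
    interpret P3_union_P2_gem_free_triangle G A
      using True A(2) by unfold_locales simp
    show ?thesis
      using six_colorable True by simp
  next
    case False
    then show ?thesis
      using colorable_if_card_neq_3 A(2) by simp
  qed
  then show ?thesis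
    by (rule chromatic_number_le)
qed

end
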